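(* $([-1,1],\oplus,-1,1)$, where $[-1,1]$ carries the Euclidean topology and $x\oplus y=\tfrac{x+y}{2}$, is a parametrised interval object in the category $\mathbf{Top}$ of topological spaces: for every space $P$, every midpoint-convex body $(A,m)$ in $\mathbf{Top}$ and all continuous $x_{-1},x_1\colon P\to A$ there is a unique continuous $h\colon P\times[-1,1]\to A$ with $h(p,-1)=x_{-1}(p)$, $h(p,1)=x_1(p)$ and $h(p,x\oplus y)=m(h(p,x),h(p,y))$.
   Context: In $\mathbf{Top}$ (products with product topology), a midpoint object is a space $A$ with continuous $m\colon A\times A\to A$ satisfying $m(x,x)=x$, $m(x,y)=m(y,x)$, $m(m(x,y),m(z,w))=m(m(x,z),m(y,w))$; cancellative if $m(x,y)=m(x,z)$ implies $y=z$; iterative if for every space $X$ and continuous $c\colon X\to A\times X$ there is a unique continuous $u\colon X\to A$ with $u=m\circ(\mathrm{id}_A\times u)\circ c$. A midpoint-convex body is a cancellative iterative midpoint object. *)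

theory Defs
  imports "HOL-Analysis.Analysis"
begin

definition midpoint_object :: "'a topology \<Rightarrow> ('a \<Rightarrow> 'a \<Rightarrow> 'a) \<Rightarrow> bool" where
  "midpoint_object A m \<longleftrightarrow>
     continuous_map (prod_topology A A) A (\<lambda>(x, y). m x y) \<and>
     (\<forall>x\<in>topspace A. m x x = x) \<and>
     (\<forall>x\<in>topspace A. \<forall>y\<in>topspace A. m x y = m y x) \<and>
     (\<forall>x\<in>topspace A. \<forall>y\<in>topspace A. \<forall>z\<in>topspace A. \<forall>w\<in>topspace A.
        m (m x y) (m z w) = m (m x z) (m y w))"

definition cancellative :: "'a topology \<Rightarrow> ('a \<Rightarrow> 'a \<Rightarrow> 'a) \<Rightarrow> bool" where
  "cancellative A m \<longleftrightarrow>
     (\<forall>x\<in>topspace A. \<forall>y\<in>topspace A. \<forall>z\<in>topspace A. m x y = m x z \<longrightarrow> y = z)"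

text \<open>Iterativity, quantifying over all test spaces X whose points live in the type 'x.\<close>
definition iterative_wrt :: "'x itself \<Rightarrow> 'a topology \<Rightarrow> ('a \<Rightarrow> 'a \<Rightarrow> 'a) \<Rightarrow> bool" where
  "iterative_wrt _ A m \<longleftrightarrow>
     (\<forall>(X :: 'x topology) c. continuous_map X (prod_topology A X) c \<longrightarrow>
        (\<exists>u. continuous_map X A u \<and>
             (\<forall>x\<in>topspace X. u x = m (fst (c x)) (u (snd (c x)))) \<and>
             (\<forall>v. continuous_map X A v \<and>
                  (\<forall>x\<in>topspace X. v x = m (fst (c x)) (v (snd (c x)))) \<longrightarrow>
                  (\<forall>x\<in>topspace X. v x = u x))))"

definition midpoint_convex_body_wrt :: "'x itself \<Rightarrow> 'a topology \<Rightarrow> ('a \<Rightarrow> 'a \<Rightarrow> 'a) \<Rightarrow> bool" where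
  "midpoint_convex_body_wrt T A m \<longleftrightarrow>
     midpoint_object A m \<and> cancellative A m \<and> iterative_wrt T A m"

end

theory Submission
  imports Defs
begin

text \<open>
  Read a sign sequence \<open>\<alpha> \<in> {-1,1}\<^sup>\<nat>\<close> as the signed binary number \<open>\<Sum>i. \<alpha> i / 2\<^sup>i\<^sup>+\<^sup>1\<close>.
  This is a continuous surjection from Cantor space onto \<open>[-1,1]\<close>; Cantor space being compact,
  it is proper, so its product with \<open>P\<close> is a quotient map.
  Iterativity applied to the digit shift yields \<open>interp\<close> on \<open>P \<times> {-1,1}\<^sup>\<nat>\<close> with
  \<open>interp (p, \<alpha>) = m (x\<^sub>\<alpha>\<^sub>0 p) (interp (p, tail \<alpha>))\<close>. By cancellativity \<open>interp\<close> sends a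
  constant sequence to the corresponding endpoint, hence agrees on the two expansions of a dyadic
  number and descends to \<open>h\<close> on \<open>P \<times> [-1,1]\<close>. For the midpoint law, interleave expansions of
  \<open>x\<close> and \<open>y\<close>: both \<open>m (h x) (h y)\<close> and \<open>h ((x + y) / 2)\<close> then solve the iteration for the
  shift by two digits. Any other solution \<open>g\<close> composed with the quotient map solves the iteration
  for the one-digit shift, so it equals \<open>h\<close>.
\<close>

section \<open>Signed binary expansions\<close>

definition sign_seqs :: "(nat \<Rightarrow> real) set" where
  "sign_seqs = {\<alpha>. \<forall>i. \<alpha> i \<in> {-1, 1}}"

definition cantor_space :: "(nat \<Rightarrow> real) topology" where
  "cantor_space = product_topology (\<lambda>_. top_of_set {-1, 1}) UNIV"

definition bin_value :: "(nat \<Rightarrow> real) \<Rightarrow> real" where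
  "bin_value \<alpha> = (\<Sum>i. \<alpha> i * (1/2) ^ Suc i)"

definition sign_digit :: "real \<Rightarrow> real" where
  "sign_digit t = (if t \<le> 0 then -1 else 1)"

lemma sign_seqs_comp: "\<alpha> \<in> sign_seqs \<Longrightarrow> \<alpha> \<circ> r \<in> sign_seqs"
  by (simp add: sign_seqs_def)

lemma sign_seqs_abs_le: "\<alpha> \<in> sign_seqs \<Longrightarrow> \<bar>\<alpha> i\<bar> \<le> 1"
  by (auto simp: sign_seqs_def dest!: spec[of _ i])

lemma topspace_cantor_space: "topspace cantor_space = sign_seqs"
  by (auto simp: cantor_space_def sign_seqs_def PiE_def extensional_def)

lemma compact_space_cantor_space: "compact_space cantor_space"
  by (auto simp: cantor_space_def compact_space_product_topology compact_space_subtopology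
      compactin_euclidean_iff finite_imp_compact)

lemma continuous_map_cantor_space_iff:
  "continuous_map X cantor_space f \<longleftrightarrow>
     (\<forall>k. continuous_map X euclideanreal (\<lambda>x. f x k)) \<and> f ` topspace X \<subseteq> sign_seqs"
  by (auto simp: cantor_space_def sign_seqs_def continuous_map_componentwise_UNIV
      continuous_map_in_subtopology)

lemma continuous_map_cantor_coordinate: "continuous_map cantor_space euclideanreal (\<lambda>\<alpha>. \<alpha> k)"
  using continuous_map_cantor_space_iff[of cantor_space id] by simp

lemma continuous_map_cantor_reindex: "continuous_map cantor_space cantor_space (\<lambda>\<alpha>. \<alpha> \<circ> r)"
  by (auto simp: continuous_map_cantor_space_iff continuous_map_cantor_coordinate
      topspace_cantor_space sign_seqs_comp)

lemma sums_half_powers: "(\<lambda>i. (1/2::real) ^ Suc i) sums 1"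
  using sums_mult[OF geometric_sums[of "1/2::real"], of "1/2"] by simp

lemma summable_bin_value:
  assumes "\<And>i. \<bar>\<alpha> i\<bar> \<le> 1"
  shows "summable (\<lambda>i. \<alpha> i * (1/2::real) ^ Suc i)"
  by (rule summable_comparison_test[OF _ sums_summable[OF sums_half_powers]])
    (use assms in \<open>auto simp: abs_mult intro!: exI[of _ 0] mult_left_le_one_le\<close>)

lemma abs_bin_value_le:
  assumes "\<And>i. \<bar>\<alpha> i\<bar> \<le> 1"
  shows "\<bar>bin_value \<alpha>\<bar> \<le> 1"
proof -
  have bound: "\<bar>\<alpha> i * (1/2::real) ^ Suc i\<bar> \<le> (1/2) ^ Suc i" for i
    using assms[of i] by (simp add: abs_mult mult_left_le_one_le)
  have summable: "summable (\<lambda>i. \<bar>\<alpha> i * (1/2::real) ^ Suc i\<bar>)"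
    by (rule summable_comparison_test[OF _ sums_summable[OF sums_half_powers]])
      (use bound in \<open>auto intro!: exI[of _ 0]\<close>)
  have "\<bar>bin_value \<alpha>\<bar> \<le> (\<Sum>i. \<bar>\<alpha> i * (1/2) ^ Suc i\<bar>)"
    unfolding bin_value_def by (rule summable_rabs[OF summable])
  also have "\<dots> \<le> (\<Sum>i. (1/2) ^ Suc i)"
    by (rule suminf_le[OF bound summable sums_summable[OF sums_half_powers]])
  finally show ?thesis
    using sums_unique[OF sums_half_powers] by simp
qed

lemma bin_value_in_interval: "\<alpha> \<in> sign_seqs \<Longrightarrow> bin_value \<alpha> \<in> {-1..1}"
  using abs_bin_value_le[of \<alpha>] sign_seqs_abs_le[of \<alpha>] by (simp add: abs_le_iff)

lemma bin_value_split:
  assumes "\<And>i. \<bar>\<alpha> i\<bar> \<le> 1"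
  shows "bin_value \<alpha> = (\<Sum>i<n. \<alpha> i * (1/2) ^ Suc i) + (1/2) ^ n * bin_value (\<lambda>i. \<alpha> (i + n))"
proof -
  have "(\<Sum>i. \<alpha> (i + n) * (1/2::real) ^ Suc (i + n)) = (\<Sum>i. (1/2) ^ n * (\<alpha> (i + n) * (1/2) ^ Suc i))"
    by (simp add: power_add mult_ac)
  also have "\<dots> = (1/2) ^ n * bin_value (\<lambda>i. \<alpha> (i + n))"
    unfolding bin_value_def by (rule suminf_mult[OF summable_bin_value]) (rule assms)
  finally show ?thesis
    using suminf_split_initial_segment[OF summable_bin_value[of \<alpha>, OF assms], of n]
    unfolding bin_value_def by simp
qed

lemma bin_value_unfold:
  assumes "\<alpha> \<in> sign_seqs"
  shows "bin_value \<alpha> = (\<alpha> 0 + bin_value (\<alpha> \<circ> Suc)) / 2"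
proof -
  have "(\<lambda>i. \<alpha> (i + 1)) = \<alpha> \<circ> Suc" by (simp add: fun_eq_iff)
  then show ?thesis
    using bin_value_split[of \<alpha> 1] sign_seqs_abs_le[OF assms] by simp
qed

lemma bin_value_approx:
  assumes "\<And>i. \<bar>\<alpha> i\<bar> \<le> 1"
  shows "\<bar>bin_value \<alpha> - (\<Sum>i<n. \<alpha> i * (1/2) ^ Suc i)\<bar> \<le> (1/2) ^ n"
proof -
  have "\<bar>bin_value (\<lambda>i. \<alpha> (i + n))\<bar> \<le> 1"
    by (rule abs_bin_value_le) (rule assms)
  then have "\<bar>(1/2) ^ n * bin_value (\<lambda>i. \<alpha> (i + n))\<bar> \<le> (1/2::real) ^ n"
    by (simp add: abs_mult mult_right_le_one_le)
  moreover have "bin_value \<alpha> - (\<Sum>i<n. \<alpha> i * (1/2) ^ Suc i) = (1/2) ^ n * bin_value (\<lambda>i. \<alpha> (i + n))"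
    using bin_value_split[of \<alpha> n, OF assms] by linarith
  ultimately show ?thesis by simp
qed

lemma bin_value_const: "bin_value (\<lambda>_. c) = c"
  using sums_unique[OF sums_mult[OF sums_half_powers, of c]] by (simp add: bin_value_def mult_ac)

lemma bin_value_eq_one_imp_digit:
  assumes "\<And>i. \<bar>\<alpha> i\<bar> \<le> 1" and "bin_value \<alpha> = 1"
  shows "\<alpha> i = 1"
proof -
  have "(\<lambda>i. (1/2::real) ^ Suc i - \<alpha> i * (1/2) ^ Suc i) sums (1 - bin_value \<alpha>)"
    unfolding bin_value_def
    by (rule sums_diff[OF sums_half_powers summable_sums[OF summable_bin_value[of \<alpha>, OF assms(1)]]])
  then have "summable (\<lambda>i. (1/2::real) ^ Suc i - \<alpha> i * (1/2) ^ Suc i)"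
    and "(\<Sum>i. (1/2::real) ^ Suc i - \<alpha> i * (1/2) ^ Suc i) = 0"
    using assms(2) by (auto simp: sums_iff)
  moreover have "0 \<le> (1/2::real) ^ Suc n - \<alpha> n * (1/2) ^ Suc n" for n
    using assms(1)[of n] by (simp add: abs_le_iff mult_left_le_one_le)
  ultimately have "(1/2::real) ^ Suc i - \<alpha> i * (1/2) ^ Suc i = 0"
    using suminf_eq_zero_iff by blast
  then show ?thesis by simp
qed

lemma bin_value_eq_sign_imp_const:
  assumes "\<epsilon> \<in> {-1, 1}" and "\<And>i. \<bar>\<alpha> i\<bar> \<le> 1" and "bin_value \<alpha> = \<epsilon>"
  shows "\<alpha> = (\<lambda>_. \<epsilon>)"
proof
  fix i
  have "bin_value (\<lambda>i. \<epsilon> * \<alpha> i) = \<epsilon> * bin_value \<alpha>"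
    using suminf_mult[OF summable_bin_value[of \<alpha>, OF assms(2)], of \<epsilon>]
    by (simp add: bin_value_def mult_ac)
  with assms have "bin_value (\<lambda>i. \<epsilon> * \<alpha> i) = 1" by auto
  then have "\<epsilon> * \<alpha> i = 1"
    by (rule bin_value_eq_one_imp_digit[rotated]) (use assms in \<open>auto simp: abs_mult\<close>)
  with assms(1) show "\<alpha> i = \<epsilon>" by auto
qed

text \<open>As with \<open>0.0111\<dots> = 0.1000\<dots>\<close> in ordinary binary.\<close>
lemma bin_value_eq_head_differs:
  assumes "\<alpha> \<in> sign_seqs" "\<beta> \<in> sign_seqs" "bin_value \<alpha> = bin_value \<beta>" "\<alpha> 0 \<noteq> \<beta> 0"
  shows "\<alpha> \<circ> Suc = (\<lambda>_. \<beta> 0)"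
proof (rule bin_value_eq_sign_imp_const)
  have signs: "\<alpha> 0 \<in> {-1, 1}" "\<beta> 0 \<in> {-1, 1}"
    using assms(1,2) by (auto simp: sign_seqs_def)
  have bounds: "bin_value (\<alpha> \<circ> Suc) \<in> {-1..1}" "bin_value (\<beta> \<circ> Suc) \<in> {-1..1}"
    by (intro bin_value_in_interval sign_seqs_comp assms(1,2))+
  have "\<alpha> 0 + bin_value (\<alpha> \<circ> Suc) = \<beta> 0 + bin_value (\<beta> \<circ> Suc)"
    using assms(3) bin_value_unfold[OF assms(1)] bin_value_unfold[OF assms(2)] by simp
  with signs bounds assms(4) show "bin_value (\<alpha> \<circ> Suc) = \<beta> 0"
    by auto
  show "\<beta> 0 \<in> {-1, 1}" by (fact signs(2))
  show "\<bar>(\<alpha> \<circ> Suc) i\<bar> \<le> 1" for i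
    using assms(1) by (simp add: sign_seqs_abs_le sign_seqs_comp)
qed

fun greedy_rest :: "real \<Rightarrow> nat \<Rightarrow> real" where
  "greedy_rest t 0 = t"
| "greedy_rest t (Suc n) = 2 * greedy_rest t n - sign_digit (greedy_rest t n)"

lemma greedy_rest_bound: "t \<in> {-1..1} \<Longrightarrow> greedy_rest t n \<in> {-1..1}"
  by (induction n) (auto simp: sign_digit_def)

lemma greedy_rest_sum:
  "(\<Sum>i<n. sign_digit (greedy_rest t i) * (1/2) ^ Suc i) + greedy_rest t n * (1/2) ^ n = t"
  by (induction n) (simp_all add: algebra_simps)

lemma bin_value_surj:
  assumes "t \<in> {-1..1}"
  shows "\<exists>\<alpha>\<in>sign_seqs. bin_value \<alpha> = t"
proof
  define \<alpha> where "\<alpha> = (\<lambda>i. sign_digit (greedy_rest t i))"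
  show "\<alpha> \<in> sign_seqs"
    by (simp add: \<alpha>_def sign_seqs_def sign_digit_def)
  have "(\<lambda>n. greedy_rest t n * (1/2::real) ^ n) \<longlonglongrightarrow> 0"
  proof (rule Lim_null_comparison)
    show "\<forall>\<^sub>F n in sequentially. norm (greedy_rest t n * (1/2::real) ^ n) \<le> (1/2) ^ n"
      using greedy_rest_bound[OF assms]
      by (auto simp: abs_mult abs_le_iff intro!: always_eventually mult_left_le_one_le)
  qed (rule LIMSEQ_power_zero, simp)
  then have "(\<lambda>n. t - greedy_rest t n * (1/2::real) ^ n) \<longlonglongrightarrow> t"
    using tendsto_diff[OF tendsto_const] by fastforce
  moreover have "(\<Sum>i<n. \<alpha> i * (1/2) ^ Suc i) = t - greedy_rest t n * (1/2) ^ n" for n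
    using greedy_rest_sum[where n = n and t = t] unfolding \<alpha>_def by linarith
  ultimately show "bin_value \<alpha> = t"
    by (simp add: bin_value_def sums_def sums_unique[symmetric])
qed

lemma bin_value_image: "bin_value ` sign_seqs = {-1..1}"
  using bin_value_in_interval bin_value_surj by blast

lemma continuous_map_bin_value: "continuous_map cantor_space euclideanreal bin_value"
proof -
  have "continuous_map cantor_space Met_TC.mtopology bin_value"
  proof (rule Met_TC.continuous_map_uniform_limit_alt
      [where F = sequentially and f = "\<lambda>n \<alpha>. \<Sum>i<n. \<alpha> i * (1/2) ^ Suc i"])
    show "\<forall>\<^sub>F n in sequentially.
        continuous_map cantor_space Met_TC.mtopology (\<lambda>\<alpha>. \<Sum>i<n. \<alpha> i * (1/2::real) ^ Suc i)"
      by (auto intro!: always_eventually continuous_intros continuous_map_cantor_coordinate)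
    fix e :: real
    assume "0 < e"
    then obtain N where N: "(1/2::real) ^ N < e"
      using real_arch_pow_inv[of e "1/2"] by auto
    show "\<forall>\<^sub>F n in sequentially. \<forall>\<alpha>\<in>topspace cantor_space.
        dist (\<Sum>i<n. \<alpha> i * (1/2) ^ Suc i) (bin_value \<alpha>) < e"
    proof (rule eventually_sequentiallyI[of N], intro ballI)
      fix n \<alpha>
      assume "N \<le> n" and "\<alpha> \<in> topspace cantor_space"
      then have "\<bar>bin_value \<alpha> - (\<Sum>i<n. \<alpha> i * (1/2) ^ Suc i)\<bar> \<le> (1/2) ^ n"
        by (intro bin_value_approx sign_seqs_abs_le) (simp add: topspace_cantor_space)
      also have "(1/2::real) ^ n \<le> (1/2) ^ N"
        using \<open>N \<le> n\<close> by (simp add: power_decreasing)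
      finally have "\<bar>bin_value \<alpha> - (\<Sum>i<n. \<alpha> i * (1/2) ^ Suc i)\<bar> \<le> (1/2) ^ N" .
      with N show "dist (\<Sum>i<n. \<alpha> i * (1/2) ^ Suc i) (bin_value \<alpha>) < e"
        by (simp add: dist_real_def abs_minus_commute)
    qed
  qed simp_all
  then show ?thesis by simp
qed

lemma proper_map_bin_value: "proper_map cantor_space (top_of_set {-1..1}) bin_value"
proof (rule continuous_closed_imp_proper_map)
  show "continuous_map cantor_space (top_of_set {-1..1}) bin_value"
    using continuous_map_bin_value bin_value_image
    by (auto simp: continuous_map_in_subtopology topspace_cantor_space)
  then show "closed_map cantor_space (top_of_set {-1..1}) bin_value"
    by (intro continuous_imp_closed_map compact_space_cantor_space Hausdorff_space_subtopology)
      simp_all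
qed (simp_all add: compact_space_cantor_space t1_space_subtopology t1_space_euclidean)

lemma quotient_map_prod_bin_value:
  "quotient_map (prod_topology P cantor_space) (prod_topology P (top_of_set {-1..1}))
     (\<lambda>(p, \<alpha>). (p, bin_value \<alpha>))"
proof (rule continuous_closed_imp_quotient_map)
  have "proper_map (prod_topology P cantor_space) (prod_topology P (top_of_set {-1..1}))
      (\<lambda>(p, \<alpha>). (id p, bin_value \<alpha>))"
    by (simp only: proper_map_prod proper_map_id proper_map_bin_value simp_thms)
  then show "closed_map (prod_topology P cantor_space) (prod_topology P (top_of_set {-1..1}))
      (\<lambda>(p, \<alpha>). (p, bin_value \<alpha>))"
    by (simp add: proper_imp_closed_map)
  show "continuous_map (prod_topology P cantor_space) (prod_topology P (top_of_set {-1..1}))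
      (\<lambda>(p, \<alpha>). (p, bin_value \<alpha>))"
    using continuous_map_bin_value bin_value_image
    by (auto simp: continuous_map_paired split_def continuous_map_in_subtopology topspace_cantor_space
        intro!: continuous_map_fst continuous_map_compose[OF continuous_map_snd, unfolded o_def])
  show "(\<lambda>(p, \<alpha>). (p, bin_value \<alpha>)) ` topspace (prod_topology P cantor_space) =
      topspace (prod_topology P (top_of_set {-1..1}))"
    by (force simp: topspace_cantor_space simp flip: bin_value_image)
qed

section \<open>Iteration in midpoint convex bodies\<close>

definition solves_iteration ::
    "'x topology \<Rightarrow> 'a topology \<Rightarrow> ('a \<Rightarrow> 'a \<Rightarrow> 'a) \<Rightarrow> ('x \<Rightarrow> 'a \<times> 'x) \<Rightarrow> ('x \<Rightarrow> 'a) \<Rightarrow> bool" where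
  "solves_iteration X A m c u \<longleftrightarrow>
     continuous_map X A u \<and> (\<forall>x\<in>topspace X. u x = m (fst (c x)) (u (snd (c x))))"

lemma iterative_wrt_solution_exists:
  fixes X :: "'x topology"
  assumes "iterative_wrt TYPE('x) A m" and "continuous_map X (prod_topology A X) c"
  shows "\<exists>u. solves_iteration X A m c u"
  using assms unfolding iterative_wrt_def solves_iteration_def by blast

lemma iterative_wrt_solutions_agree:
  fixes X :: "'x topology"
  assumes "iterative_wrt TYPE('x) A m" and "continuous_map X (prod_topology A X) c"
    and "solves_iteration X A m c v" and "solves_iteration X A m c w" and "x \<in> topspace X"
  shows "v x = w x"
proof -
  obtain u where "\<forall>v. solves_iteration X A m c v \<longrightarrow> (\<forall>x\<in>topspace X. v x = u x)"
    using assms(1,2) unfolding iterative_wrt_def solves_iteration_def by blast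
  with assms(3-5) show ?thesis by metis
qed

locale midpoint_body =
  fixes A :: "'a topology" and m :: "'a \<Rightarrow> 'a \<Rightarrow> 'a"
  assumes midpoint_object: "midpoint_object A m" and cancellative: "cancellative A m"
begin

lemma continuous_map_mid:
  "continuous_map X A f \<Longrightarrow> continuous_map X A g \<Longrightarrow> continuous_map X A (\<lambda>x. m (f x) (g x))"
  using continuous_map_compose[of X "prod_topology A A" "\<lambda>x. (f x, g x)" A "\<lambda>(x, y). m x y"]
    midpoint_object
  by (simp add: midpoint_object_def o_def continuous_map_paired)

lemma mid_idem: "x \<in> topspace A \<Longrightarrow> m x x = x"
  using midpoint_object by (simp add: midpoint_object_def)

lemma mid_commute: "x \<in> topspace A \<Longrightarrow> y \<in> topspace A \<Longrightarrow> m x y = m y x"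
  using midpoint_object by (simp add: midpoint_object_def)

lemma mid_medial:
  "x \<in> topspace A \<Longrightarrow> y \<in> topspace A \<Longrightarrow> z \<in> topspace A \<Longrightarrow> w \<in> topspace A \<Longrightarrow>
     m (m x y) (m z w) = m (m x z) (m y w)"
  using midpoint_object by (simp add: midpoint_object_def)

lemma mid_fixed_point: "a \<in> topspace A \<Longrightarrow> z \<in> topspace A \<Longrightarrow> m a z = z \<Longrightarrow> z = a"
  using cancellative mid_idem mid_commute unfolding cancellative_def by metis

end

section \<open>The interval map\<close>

text \<open>Iterativity is only used for the test space \<open>P \<times> {-1,1}\<^sup>\<nat>\<close>.\<close>
locale binary_interval = midpoint_body A m
  for A :: "'a topology" and m :: "'a \<Rightarrow> 'a \<Rightarrow> 'a" +
  fixes P :: "'p topology" and xm xp :: "'p \<Rightarrow> 'a"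
  assumes iterative: "iterative_wrt TYPE('p \<times> (nat \<Rightarrow> real)) A m"
    and continuous_xm: "continuous_map P A xm" and continuous_xp: "continuous_map P A xp"
begin

abbreviation P_cantor :: "('p \<times> (nat \<Rightarrow> real)) topology" where
  "P_cantor \<equiv> prod_topology P cantor_space"

abbreviation P_interval :: "('p \<times> real) topology" where
  "P_interval \<equiv> prod_topology P (top_of_set {-1..1})"

definition endpoint :: "real \<Rightarrow> 'p \<Rightarrow> 'a" where
  "endpoint \<epsilon> p = (if \<epsilon> \<le> 0 then xm p else xp p)"

lemma endpoint_in_topspace: "p \<in> topspace P \<Longrightarrow> endpoint \<epsilon> p \<in> topspace A"
  using continuous_map_image_subset_topspace[OF continuous_xm]
    continuous_map_image_subset_topspace[OF continuous_xp]
  by (auto simp: endpoint_def)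

lemma continuous_map_endpoint: "continuous_map P_cantor A (\<lambda>(p, \<alpha>). endpoint (\<alpha> k) p)"
proof -
  have coordinate: "continuous_map P_cantor euclideanreal (\<lambda>x. snd x k)"
    using continuous_map_compose[OF continuous_map_snd continuous_map_cantor_coordinate]
    by (simp add: o_def)
  have "continuous_map P_cantor A (\<lambda>x. if snd x k \<le> 0 then xm (fst x) else xp (fst x))"
  proof (rule continuous_map_cases_le[OF coordinate])
    show "continuous_map (subtopology P_cantor {x \<in> topspace P_cantor. snd x k \<le> 0}) A (\<lambda>x. xm (fst x))"
      by (intro continuous_map_from_subtopology continuous_map_compose[OF continuous_map_fst continuous_xm, unfolded o_def])
    show "continuous_map (subtopology P_cantor {x \<in> topspace P_cantor. 0 \<le> snd x k}) A (\<lambda>x. xp (fst x))"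
      by (intro continuous_map_from_subtopology continuous_map_compose[OF continuous_map_fst continuous_xp, unfolded o_def])
    show "xm (fst x) = xp (fst x)" if "x \<in> topspace P_cantor" and "snd x k = 0" for x
      using that by (auto simp: topspace_cantor_space sign_seqs_def dest!: spec[of _ k])
  qed simp
  then show ?thesis by (simp add: endpoint_def split_def)
qed

lemma continuous_map_reindex_fibre: "continuous_map P_cantor P_cantor (\<lambda>(p, \<alpha>). (p, \<alpha> \<circ> r))"
proof -
  have "continuous_map P_cantor cantor_space ((\<lambda>\<alpha>. \<alpha> \<circ> r) \<circ> snd)"
    by (rule continuous_map_compose[OF continuous_map_snd continuous_map_cantor_reindex])
  then have "continuous_map P_cantor cantor_space (\<lambda>x. snd x \<circ> r)"
    by (rule continuous_map_eq) simp
  then show ?thesis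
    by (simp add: continuous_map_paired split_def continuous_map_fst)
qed

definition shift_step :: "'p \<times> (nat \<Rightarrow> real) \<Rightarrow> 'a \<times> ('p \<times> (nat \<Rightarrow> real))" where
  "shift_step = (\<lambda>(p, \<alpha>). (endpoint (\<alpha> 0) p, (p, \<alpha> \<circ> Suc)))"

lemma continuous_map_shift_step: "continuous_map P_cantor (prod_topology A P_cantor) shift_step"
  using continuous_map_endpoint continuous_map_reindex_fibre
  by (simp add: shift_step_def continuous_map_paired split_def)

definition interp :: "'p \<times> (nat \<Rightarrow> real) \<Rightarrow> 'a" where
  "interp = (SOME u. solves_iteration P_cantor A m shift_step u)"

lemma interp_solves: "solves_iteration P_cantor A m shift_step interp"
  unfolding interp_def
  by (rule someI_ex[OF iterative_wrt_solution_exists[OF iterative continuous_map_shift_step]])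

lemma continuous_map_interp: "continuous_map P_cantor A interp"
  using interp_solves by (simp add: solves_iteration_def)

lemma interp_in_topspace: "p \<in> topspace P \<Longrightarrow> \<alpha> \<in> sign_seqs \<Longrightarrow> interp (p, \<alpha>) \<in> topspace A"
  using continuous_map_image_subset_topspace[OF continuous_map_interp]
  by (auto simp: topspace_cantor_space)

lemma interp_unfold:
  "p \<in> topspace P \<Longrightarrow> \<alpha> \<in> sign_seqs \<Longrightarrow> interp (p, \<alpha>) = m (endpoint (\<alpha> 0) p) (interp (p, \<alpha> \<circ> Suc))"
  using interp_solves by (auto simp: solves_iteration_def shift_step_def topspace_cantor_space)

lemma interp_const:
  assumes "p \<in> topspace P" and "\<epsilon> \<in> {-1, 1}"
  shows "interp (p, \<lambda>_. \<epsilon>) = endpoint \<epsilon> p"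
proof (rule mid_fixed_point[OF endpoint_in_topspace[OF assms(1)]])
  have const: "(\<lambda>_. \<epsilon>) \<in> sign_seqs"
    using assms(2) by (simp add: sign_seqs_def)
  then show "interp (p, \<lambda>_. \<epsilon>) \<in> topspace A"
    by (rule interp_in_topspace[OF assms(1)])
  show "m (endpoint \<epsilon> p) (interp (p, \<lambda>_. \<epsilon>)) = interp (p, \<lambda>_. \<epsilon>)"
    using interp_unfold[OF assms(1) const] by (simp add: o_def)
qed

lemma interp_eq_if_first_difference:
  assumes "p \<in> topspace P"
  shows "\<alpha> \<in> sign_seqs \<Longrightarrow> \<beta> \<in> sign_seqs \<Longrightarrow> bin_value \<alpha> = bin_value \<beta> \<Longrightarrow>
    \<forall>i<n. \<alpha> i = \<beta> i \<Longrightarrow> \<alpha> n \<noteq> \<beta> n \<Longrightarrow> interp (p, \<alpha>) = interp (p, \<beta>)"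
proof (induction n arbitrary: \<alpha> \<beta>)
  case 0
  have tails: "\<alpha> \<circ> Suc = (\<lambda>_. \<beta> 0)" "\<beta> \<circ> Suc = (\<lambda>_. \<alpha> 0)"
    using bin_value_eq_head_differs[OF "0.prems"(1-3,5)]
      bin_value_eq_head_differs[OF "0.prems"(2,1) "0.prems"(3)[symmetric] "0.prems"(5)[symmetric]]
    by simp_all
  have signs: "\<alpha> 0 \<in> {-1, 1}" "\<beta> 0 \<in> {-1, 1}"
    using "0.prems"(1,2) by (auto simp: sign_seqs_def)
  have "interp (p, \<alpha>) = m (endpoint (\<alpha> 0) p) (endpoint (\<beta> 0) p)"
    using interp_unfold[OF assms "0.prems"(1)] tails interp_const[OF assms signs(2)] by simp
  also have "\<dots> = m (endpoint (\<beta> 0) p) (endpoint (\<alpha> 0) p)"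
    by (intro mid_commute endpoint_in_topspace assms)
  also have "\<dots> = interp (p, \<beta>)"
    using interp_unfold[OF assms "0.prems"(2)] tails interp_const[OF assms signs(1)] by simp
  finally show ?case .
next
  case (Suc n)
  have head: "\<alpha> 0 = \<beta> 0"
    using Suc.prems(4) by auto
  have "bin_value \<alpha> = (\<alpha> 0 + bin_value (\<alpha> \<circ> Suc)) / 2"
    "bin_value \<beta> = (\<beta> 0 + bin_value (\<beta> \<circ> Suc)) / 2"
    by (rule bin_value_unfold[OF Suc.prems(1)], rule bin_value_unfold[OF Suc.prems(2)])
  with head Suc.prems(3) have "bin_value (\<alpha> \<circ> Suc) = bin_value (\<beta> \<circ> Suc)"
    by simp
  moreover have "\<forall>i<n. (\<alpha> \<circ> Suc) i = (\<beta> \<circ> Suc) i" "(\<alpha> \<circ> Suc) n \<noteq> (\<beta> \<circ> Suc) n"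
    using Suc.prems(4,5) by auto
  ultimately have "interp (p, \<alpha> \<circ> Suc) = interp (p, \<beta> \<circ> Suc)"
    using Suc.IH Suc.prems(1,2) sign_seqs_comp by blast
  with head show ?case
    using interp_unfold[OF assms Suc.prems(1)] interp_unfold[OF assms Suc.prems(2)] by simp
qed

lemma interp_eq_if_bin_value_eq:
  assumes "p \<in> topspace P" "\<alpha> \<in> sign_seqs" "\<beta> \<in> sign_seqs" "bin_value \<alpha> = bin_value \<beta>"
  shows "interp (p, \<alpha>) = interp (p, \<beta>)"
proof (cases "\<alpha> = \<beta>")
  case False
  then obtain n where "\<alpha> n \<noteq> \<beta> n" "\<forall>i<n. \<alpha> i = \<beta> i"
    using exists_least_iff[of "\<lambda>n. \<alpha> n \<noteq> \<beta> n"] by (auto simp: fun_eq_iff)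
  with assms show ?thesis
    by (intro interp_eq_if_first_difference)
qed simp

text \<open>The choice of expansion is irrelevant by \<open>interp_eq_if_bin_value_eq\<close>.\<close>
definition interval_hom :: "'p \<times> real \<Rightarrow> 'a" where
  "interval_hom = (\<lambda>(p, t). interp (p, SOME \<alpha>. \<alpha> \<in> sign_seqs \<and> bin_value \<alpha> = t))"

lemma interval_hom_bin_value:
  assumes "p \<in> topspace P" and "\<alpha> \<in> sign_seqs"
  shows "interval_hom (p, bin_value \<alpha>) = interp (p, \<alpha>)"
proof -
  have "\<exists>\<beta>. \<beta> \<in> sign_seqs \<and> bin_value \<beta> = bin_value \<alpha>"
    using assms(2) by blast
  then have "(SOME \<beta>. \<beta> \<in> sign_seqs \<and> bin_value \<beta> = bin_value \<alpha>) \<in> sign_seqs \<and>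
      bin_value (SOME \<beta>. \<beta> \<in> sign_seqs \<and> bin_value \<beta> = bin_value \<alpha>) = bin_value \<alpha>"
    by (rule someI_ex)
  with assms show ?thesis
    by (auto simp: interval_hom_def intro: interp_eq_if_bin_value_eq)
qed

lemma continuous_map_interval_hom: "continuous_map P_interval A interval_hom"
proof (rule continuous_compose_quotient_map[OF quotient_map_prod_bin_value])
  show "continuous_map P_cantor A (interval_hom \<circ> (\<lambda>(p, \<alpha>). (p, bin_value \<alpha>)))"
    by (rule continuous_map_eq[OF continuous_map_interp])
      (auto simp: topspace_cantor_space interval_hom_bin_value)
qed

lemma interval_hom_in_topspace:
  "p \<in> topspace P \<Longrightarrow> t \<in> {-1..1} \<Longrightarrow> interval_hom (p, t) \<in> topspace A"
  using continuous_map_image_subset_topspace[OF continuous_map_interval_hom] by auto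

lemma interval_hom_sign:
  "p \<in> topspace P \<Longrightarrow> \<epsilon> \<in> {-1, 1} \<Longrightarrow> interval_hom (p, \<epsilon>) = endpoint \<epsilon> p"
  using interval_hom_bin_value[of p "\<lambda>_. \<epsilon>"] interp_const[of p \<epsilon>]
  by (simp add: bin_value_const sign_seqs_def)

lemma interval_hom_step:
  assumes "p \<in> topspace P" "\<epsilon> \<in> {-1, 1}" "t \<in> {-1..1}"
  shows "interval_hom (p, (\<epsilon> + t) / 2) = m (interval_hom (p, \<epsilon>)) (interval_hom (p, t))"
proof -
  obtain \<alpha> where \<alpha>: "\<alpha> \<in> sign_seqs" "bin_value \<alpha> = t"
    using bin_value_surj[OF assms(3)] by blast
  define \<beta> where "\<beta> = case_nat \<epsilon> \<alpha>"
  have \<beta>: "\<beta> \<in> sign_seqs" "\<beta> 0 = \<epsilon>" "\<beta> \<circ> Suc = \<alpha>"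
    using \<alpha>(1) assms(2) by (auto simp: \<beta>_def sign_seqs_def fun_eq_iff split: nat.splits)
  then have "interval_hom (p, (\<epsilon> + t) / 2) = interp (p, \<beta>)"
    using interval_hom_bin_value[OF assms(1) \<beta>(1)] bin_value_unfold[OF \<beta>(1)] \<alpha>(2) by simp
  also have "\<dots> = m (endpoint \<epsilon> p) (interp (p, \<alpha>))"
    using interp_unfold[OF assms(1) \<beta>(1)] \<beta>(2,3) by simp
  also have "\<dots> = m (interval_hom (p, \<epsilon>)) (interval_hom (p, t))"
    using interval_hom_sign[OF assms(1,2)] interval_hom_bin_value[OF assms(1) \<alpha>(1)] \<alpha>(2) by simp
  finally show ?thesis .
qed

lemma interval_hom_half:
  assumes p: "p \<in> topspace P" and t: "t \<in> {-1..1}"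
  shows "interval_hom (p, t / 2) = m (interval_hom (p, 0)) (interval_hom (p, t))"
proof -
  let ?h = "\<lambda>t. interval_hom (p, t)"
  define \<epsilon> where "\<epsilon> = sign_digit t"
  define s where "s = 2 * t - \<epsilon>"
  have \<epsilon>: "\<epsilon> \<in> {-1, 1}" "-\<epsilon> \<in> {-1, 1}" "-\<epsilon> \<in> {-1..1}"
    by (auto simp: \<epsilon>_def sign_digit_def)
  have s: "s \<in> {-1..1}" "(-\<epsilon> + s) / 2 \<in> {-1..1}"
    using t by (auto simp: s_def \<epsilon>_def sign_digit_def)
  have in_A: "?h \<epsilon> \<in> topspace A" "?h (-\<epsilon>) \<in> topspace A" "?h s \<in> topspace A"
    using \<epsilon> s by (auto intro!: interval_hom_in_topspace p)
  have zero: "?h 0 = m (?h \<epsilon>) (?h (-\<epsilon>))"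
    using interval_hom_step[OF p \<epsilon>(1) \<epsilon>(3)] by simp
  have "?h t = ?h ((\<epsilon> + s) / 2)"
    by (simp add: s_def)
  also have "\<dots> = m (?h \<epsilon>) (?h s)"
    by (rule interval_hom_step[OF p \<epsilon>(1) s(1)])
  finally have t_eq: "?h t = m (?h \<epsilon>) (?h s)" .
  have "?h (t / 2) = ?h ((\<epsilon> + (-\<epsilon> + s) / 2) / 2)"
    by (simp add: s_def field_simps)
  also have "\<dots> = m (?h \<epsilon>) (?h ((-\<epsilon> + s) / 2))"
    by (rule interval_hom_step[OF p \<epsilon>(1) s(2)])
  also have "?h ((-\<epsilon> + s) / 2) = m (?h (-\<epsilon>)) (?h s)"
    by (rule interval_hom_step[OF p \<epsilon>(2) s(1)])
  also have "m (?h \<epsilon>) (m (?h (-\<epsilon>)) (?h s)) = m (m (?h \<epsilon>) (?h \<epsilon>)) (m (?h (-\<epsilon>)) (?h s))"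
    by (simp only: mid_idem[OF in_A(1)])
  also have "\<dots> = m (m (?h \<epsilon>) (?h (-\<epsilon>))) (m (?h \<epsilon>) (?h s))"
    by (rule mid_medial[OF in_A(1,1,2,3)])
  also have "\<dots> = m (?h 0) (?h t)"
    by (simp only: zero t_eq)
  finally show ?thesis .
qed

lemma interval_hom_vertex_step:
  assumes "p \<in> topspace P" "c \<in> {-1, 0, 1}" "t \<in> {-1..1}"
  shows "interval_hom (p, (c + t) / 2) = m (interval_hom (p, c)) (interval_hom (p, t))"
  using assms interval_hom_half[OF assms(1,3)] interval_hom_step[OF assms(1) _ assms(3)] by auto

definition pair_step :: "'p \<times> (nat \<Rightarrow> real) \<Rightarrow> 'a \<times> ('p \<times> (nat \<Rightarrow> real))" where
  "pair_step = (\<lambda>(p, \<gamma>). (m (endpoint (\<gamma> 0) p) (endpoint (\<gamma> 1) p), (p, \<gamma> \<circ> Suc \<circ> Suc)))"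

lemma continuous_map_pair_step: "continuous_map P_cantor (prod_topology A P_cantor) pair_step"
  using continuous_map_mid[OF continuous_map_endpoint continuous_map_endpoint]
    continuous_map_reindex_fibre[of "Suc \<circ> Suc"]
  by (simp add: pair_step_def continuous_map_paired split_def o_assoc)

lemma continuous_map_interp_reindex: "continuous_map P_cantor A (\<lambda>(p, \<gamma>). interp (p, \<gamma> \<circ> r))"
  using continuous_map_compose[OF continuous_map_reindex_fibre continuous_map_interp]
  by (simp add: o_def split_def)

lemma interleaved_interp_solves:
  "solves_iteration P_cantor A m pair_step
     (\<lambda>(p, \<gamma>). m (interp (p, \<gamma> \<circ> (*) 2)) (interp (p, \<gamma> \<circ> Suc \<circ> (*) 2)))"
  unfolding solves_iteration_def
proof (intro conjI ballI)
  show "continuous_map P_cantor A (\<lambda>(p, \<gamma>). m (interp (p, \<gamma> \<circ> (*) 2)) (interp (p, \<gamma> \<circ> Suc \<circ> (*) 2)))"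
    using continuous_map_mid[OF continuous_map_interp_reindex[of "(*) 2"]
        continuous_map_interp_reindex[of "Suc \<circ> (*) 2"]]
    by (simp add: split_def o_assoc)
  fix x
  assume "x \<in> topspace P_cantor"
  then obtain p \<gamma> where x: "x = (p, \<gamma>)" and p: "p \<in> topspace P" and \<gamma>: "\<gamma> \<in> sign_seqs"
    by (auto simp: topspace_cantor_space)
  let ?\<gamma>' = "\<gamma> \<circ> Suc \<circ> Suc"
  have \<gamma>': "?\<gamma>' \<circ> (*) 2 \<in> sign_seqs" "?\<gamma>' \<circ> Suc \<circ> (*) 2 \<in> sign_seqs"
    using \<gamma> by (simp_all add: sign_seqs_comp)
  have "interp (p, \<gamma> \<circ> (*) 2) = m (endpoint (\<gamma> 0) p) (interp (p, ?\<gamma>' \<circ> (*) 2))"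
    using interp_unfold[OF p sign_seqs_comp[OF \<gamma>, of "(*) 2"]]
    by (simp add: o_def)
  moreover have "interp (p, \<gamma> \<circ> Suc \<circ> (*) 2) = m (endpoint (\<gamma> 1) p) (interp (p, ?\<gamma>' \<circ> Suc \<circ> (*) 2))"
    using interp_unfold[OF p sign_seqs_comp[OF \<gamma>, of "Suc \<circ> (*) 2"]]
    by (simp add: o_def)
  ultimately show "(\<lambda>(p, \<gamma>). m (interp (p, \<gamma> \<circ> (*) 2)) (interp (p, \<gamma> \<circ> Suc \<circ> (*) 2))) x =
      m (fst (pair_step x))
        ((\<lambda>(p, \<gamma>). m (interp (p, \<gamma> \<circ> (*) 2)) (interp (p, \<gamma> \<circ> Suc \<circ> (*) 2))) (snd (pair_step x)))"
    using mid_medial[OF endpoint_in_topspace[OF p] interp_in_topspace[OF p \<gamma>'(1)]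
        endpoint_in_topspace[OF p] interp_in_topspace[OF p \<gamma>'(2)]]
    by (simp add: x pair_step_def)
qed

lemma continuous_map_bin_value_reindex:
  "continuous_map P_cantor euclideanreal (\<lambda>(p, \<gamma>). bin_value (\<gamma> \<circ> r))"
  using continuous_map_compose[OF continuous_map_compose[OF continuous_map_snd continuous_map_cantor_reindex]
      continuous_map_bin_value]
  by (simp add: o_def split_def)

lemma interleaved_hom_solves:
  "solves_iteration P_cantor A m pair_step
     (\<lambda>(p, \<gamma>). interval_hom (p, (bin_value (\<gamma> \<circ> (*) 2) + bin_value (\<gamma> \<circ> Suc \<circ> (*) 2)) / 2))"
  unfolding solves_iteration_def
proof (intro conjI ballI)
  let ?t = "\<lambda>\<gamma>. (bin_value (\<gamma> \<circ> (*) 2) + bin_value (\<gamma> \<circ> Suc \<circ> (*) 2)) / 2"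
  have "continuous_map P_cantor euclideanreal (\<lambda>x. ?t (snd x))"
    using continuous_map_bin_value_reindex[of "(*) 2"] continuous_map_bin_value_reindex[of "Suc \<circ> (*) 2"]
    by (intro continuous_intros) (simp_all add: split_def o_assoc)
  moreover have "?t \<gamma> \<in> {-1..1}" if "\<gamma> \<in> sign_seqs" for \<gamma>
    using bin_value_in_interval[OF sign_seqs_comp[OF that, of "(*) 2"]]
      bin_value_in_interval[OF sign_seqs_comp[OF that, of "Suc \<circ> (*) 2"]]
    by (auto simp: o_assoc)
  ultimately have "continuous_map P_cantor P_interval (\<lambda>x. (fst x, ?t (snd x)))"
    by (auto simp: continuous_map_paired continuous_map_in_subtopology topspace_cantor_space
        continuous_map_fst)
  from continuous_map_compose[OF this continuous_map_interval_hom]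
  show "continuous_map P_cantor A (\<lambda>(p, \<gamma>). interval_hom (p, ?t \<gamma>))"
    by (simp add: o_def split_def)
  fix x
  assume "x \<in> topspace P_cantor"
  then obtain p \<gamma> where x: "x = (p, \<gamma>)" and p: "p \<in> topspace P" and \<gamma>: "\<gamma> \<in> sign_seqs"
    by (auto simp: topspace_cantor_space)
  let ?\<gamma>' = "\<gamma> \<circ> Suc \<circ> Suc"
  define a where "a = bin_value (?\<gamma>' \<circ> (*) 2)"
  define b where "b = bin_value (?\<gamma>' \<circ> Suc \<circ> (*) 2)"
  have "?\<gamma>' \<circ> (*) 2 \<in> sign_seqs" "?\<gamma>' \<circ> Suc \<circ> (*) 2 \<in> sign_seqs"
    using \<gamma> by (simp_all add: sign_seqs_comp)
  then have "a \<in> {-1..1}" "b \<in> {-1..1}"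
    unfolding a_def b_def by (blast intro: bin_value_in_interval)+
  then have ab: "(a + b) / 2 \<in> {-1..1}"
    by auto
  have signs: "\<gamma> 0 \<in> {-1, 1}" "\<gamma> 1 \<in> {-1, 1}" "\<gamma> 1 \<in> {-1..1}"
    using \<gamma> by (auto simp: sign_seqs_def dest!: spec[of _ 0] spec[of _ 1])
  have "bin_value (\<gamma> \<circ> (*) 2) = (\<gamma> 0 + a) / 2"
    using bin_value_unfold[OF sign_seqs_comp[OF \<gamma>, of "(*) 2"]] by (simp add: a_def o_def)
  moreover have "bin_value (\<gamma> \<circ> Suc \<circ> (*) 2) = (\<gamma> 1 + b) / 2"
    using bin_value_unfold[OF sign_seqs_comp[OF \<gamma>, of "Suc \<circ> (*) 2"]] by (simp add: b_def o_def)
  ultimately have "?t \<gamma> = ((\<gamma> 0 + \<gamma> 1) / 2 + (a + b) / 2) / 2"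
    by (simp add: field_simps)
  moreover have vertex: "(\<gamma> 0 + \<gamma> 1) / 2 \<in> {-1, 0, 1}"
    using signs by auto
  moreover have "interval_hom (p, (\<gamma> 0 + \<gamma> 1) / 2) = m (endpoint (\<gamma> 0) p) (endpoint (\<gamma> 1) p)"
    using interval_hom_step[OF p signs(1,3)] interval_hom_sign[OF p] signs by simp
  ultimately have "interval_hom (p, ?t \<gamma>) =
      m (m (endpoint (\<gamma> 0) p) (endpoint (\<gamma> 1) p)) (interval_hom (p, (a + b) / 2))"
    by (simp only: interval_hom_vertex_step[OF p vertex ab])
  then show "(\<lambda>(p, \<gamma>). interval_hom (p, ?t \<gamma>)) x =
      m (fst (pair_step x)) ((\<lambda>(p, \<gamma>). interval_hom (p, ?t \<gamma>)) (snd (pair_step x)))"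
    by (simp add: x pair_step_def a_def b_def)
qed

lemma interval_hom_midpoint:
  assumes p: "p \<in> topspace P" and "x \<in> {-1..1}" "y \<in> {-1..1}"
  shows "interval_hom (p, (x + y) / 2) = m (interval_hom (p, x)) (interval_hom (p, y))"
proof -
  obtain \<alpha> \<beta> where \<alpha>: "\<alpha> \<in> sign_seqs" "bin_value \<alpha> = x" and \<beta>: "\<beta> \<in> sign_seqs" "bin_value \<beta> = y"
    using bin_value_surj assms(2,3) by meson
  define \<gamma> where "\<gamma> i = (if even i then \<alpha> (i div 2) else \<beta> (i div 2))" for i
  have \<gamma>: "\<gamma> \<circ> (*) 2 = \<alpha>" "\<gamma> \<circ> Suc \<circ> (*) 2 = \<beta>" "\<gamma> \<in> sign_seqs"
    using \<alpha>(1) \<beta>(1) by (auto simp: \<gamma>_def fun_eq_iff sign_seqs_def)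
  have "m (interp (p, \<alpha>)) (interp (p, \<beta>)) = interval_hom (p, (x + y) / 2)"
    using iterative_wrt_solutions_agree[OF iterative continuous_map_pair_step
        interleaved_interp_solves interleaved_hom_solves, of "(p, \<gamma>)"] p \<gamma> \<alpha>(2) \<beta>(2)
    by (simp add: topspace_cantor_space)
  with \<alpha> \<beta> show ?thesis
    using interval_hom_bin_value[OF p] by auto
qed

lemma solves_iteration_bin_value_comp:
  assumes g: "continuous_map P_interval A g"
    and ends: "\<forall>p\<in>topspace P. g (p, -1) = xm p \<and> g (p, 1) = xp p"
    and mid: "\<forall>p\<in>topspace P. \<forall>x\<in>{-1..1}. \<forall>y\<in>{-1..1}. g (p, (x + y) / 2) = m (g (p, x)) (g (p, y))"
  shows "solves_iteration P_cantor A m shift_step (\<lambda>(p, \<alpha>). g (p, bin_value \<alpha>))"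
  unfolding solves_iteration_def
proof (intro conjI ballI)
  show "continuous_map P_cantor A (\<lambda>(p, \<alpha>). g (p, bin_value \<alpha>))"
    using continuous_map_compose[OF quotient_imp_continuous_map[OF quotient_map_prod_bin_value] g]
    by (simp add: o_def split_def)
  fix x
  assume "x \<in> topspace P_cantor"
  then obtain p \<alpha> where x: "x = (p, \<alpha>)" and p: "p \<in> topspace P" and \<alpha>: "\<alpha> \<in> sign_seqs"
    by (auto simp: topspace_cantor_space)
  have head: "\<alpha> 0 \<in> {-1, 1}" and "\<alpha> 0 \<in> {-1..1}"
    using \<alpha> by (auto simp: sign_seqs_def dest!: spec[of _ 0])
  have tail: "bin_value (\<alpha> \<circ> Suc) \<in> {-1..1}"
    by (intro bin_value_in_interval sign_seqs_comp \<alpha>)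
  have "g (p, bin_value \<alpha>) = g (p, (\<alpha> 0 + bin_value (\<alpha> \<circ> Suc)) / 2)"
    by (simp only: bin_value_unfold[OF \<alpha>])
  also have "\<dots> = m (g (p, \<alpha> 0)) (g (p, bin_value (\<alpha> \<circ> Suc)))"
    using mid p \<open>\<alpha> 0 \<in> {-1..1}\<close> tail by blast
  also have "g (p, \<alpha> 0) = endpoint (\<alpha> 0) p"
    using ends p head by (auto simp: endpoint_def)
  finally have "g (p, bin_value \<alpha>) = m (endpoint (\<alpha> 0) p) (g (p, bin_value (\<alpha> \<circ> Suc)))" .
  then show "(\<lambda>(p, \<alpha>). g (p, bin_value \<alpha>)) x =
      m (fst (shift_step x)) ((\<lambda>(p, \<alpha>). g (p, bin_value \<alpha>)) (snd (shift_step x)))"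
    by (simp add: x shift_step_def)
qed

lemma interval_hom_unique:
  assumes "continuous_map P_interval A g"
    and "\<forall>p\<in>topspace P. g (p, -1) = xm p \<and> g (p, 1) = xp p"
    and "\<forall>p\<in>topspace P. \<forall>x\<in>{-1..1}. \<forall>y\<in>{-1..1}. g (p, (x + y) / 2) = m (g (p, x)) (g (p, y))"
    and p: "p \<in> topspace P" and t: "t \<in> {-1..1}"
  shows "g (p, t) = interval_hom (p, t)"
proof -
  obtain \<alpha> where \<alpha>: "\<alpha> \<in> sign_seqs" "bin_value \<alpha> = t"
    using bin_value_surj[OF t] by blast
  have "g (p, bin_value \<alpha>) = interp (p, \<alpha>)"
    using iterative_wrt_solutions_agree[OF iterative continuous_map_shift_step
        solves_iteration_bin_value_comp[OF assms(1-3)] interp_solves, of "(p, \<alpha>)"] p \<alpha>(1)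
    by (simp add: topspace_cantor_space)
  with \<alpha> show ?thesis
    using interval_hom_bin_value[OF p \<alpha>(1)] by simp
qed

end

theorem mainTheorem18:
  fixes P :: "'p topology" and A :: "'a topology" and m :: "'a \<Rightarrow> 'a \<Rightarrow> 'a"
    and xm xp :: "'p \<Rightarrow> 'a"
  assumes "midpoint_convex_body_wrt TYPE('p \<times> (nat \<Rightarrow> real)) A m"
    and "continuous_map P A xm" and "continuous_map P A xp"
  shows "\<exists>h. continuous_map (prod_topology P (subtopology euclideanreal {-1..1})) A h \<and>
             (\<forall>p\<in>topspace P. h (p, -1) = xm p \<and> h (p, 1) = xp p) \<and>
             (\<forall>p\<in>topspace P. \<forall>x\<in>{-1..1}. \<forall>y\<in>{-1..1}.
                 h (p, (x + y) / 2) = m (h (p, x)) (h (p, y))) \<and>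
             (\<forall>g. continuous_map (prod_topology P (subtopology euclideanreal {-1..1})) A g \<and>
                  (\<forall>p\<in>topspace P. g (p, -1) = xm p \<and> g (p, 1) = xp p) \<and>
                  (\<forall>p\<in>topspace P. \<forall>x\<in>{-1..1}. \<forall>y\<in>{-1..1}.
                      g (p, (x + y) / 2) = m (g (p, x)) (g (p, y))) \<longrightarrow>
                  (\<forall>p\<in>topspace P. \<forall>t\<in>{-1..1}. g (p, t) = h (p, t)))"
proof -
  interpret binary_interval A m P xm xp
    using assms by unfold_locales (auto simp: midpoint_convex_body_wrt_def)
  show ?thesis
  proof (intro exI[of _ interval_hom] conjI ballI allI impI)
    show "continuous_map P_interval A interval_hom"
      by (rule continuous_map_interval_hom)
    show "interval_hom (p, -1) = xm p" "interval_hom (p, 1) = xp p" if "p \<in> topspace P" for p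
      using interval_hom_sign[OF that] by (auto simp: endpoint_def)
    show "interval_hom (p, (x + y) / 2) = m (interval_hom (p, x)) (interval_hom (p, y))"
      if "p \<in> topspace P" "x \<in> {-1..1}" "y \<in> {-1..1}" for p x y
      using interval_hom_midpoint that by blast
  qed (use interval_hom_unique in blast)
qed

end
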